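(* Let $A$ be a subset, and $B$ a proper subspace, of $\mathbb{R}^\eta$. Let $\mathbf{x}_0\in B$ and $\mathbf{x}_n:=\mathrm{CRM}^n(\mathbf{x}_0)$. Suppose further that the following hold: (i) For all $n$, $\mathbf{x}_n\in B$. (ii) $\mathbf{x}_n\to\mathbf{y}\in B\cap A$, with $\xi>0$ satisfying $\mathbf{x}_n\in\mathbb{B}_\xi(\mathbf{y})$ for all $n$. (iii) There exist $\mathbf{u}\in B^\perp\cap\mathbb{B}_1(\mathbf{0})$ and $\Theta:B\to\mathbb{R}$ such that, for all $n$, $P_A(\mathbf{x}_n)=P_{\operatorname{gra}\Theta}(\mathbf{x}_n)$, where $\operatorname{gra}\Theta:=\{\mathbf{x}+\Theta(\mathbf{x})\cdot\mathbf{u}:\mathbf{x}\in B\}$. (iv) For all $n$, the set $\operatorname{aff}\{\mathbf{x}_n,\mathbf{x}_{n+1}\}\cap A\cap B\cap\mathbb{B}_\xi(\mathbf{y})$ is a singleton, whose element is named $\mathbf{s}_n$. (v) For the functions $\theta_n:\mathbb{R}\to\mathbb{R}$, $$\theta_n(r)=\Theta\left(r\,\frac{\mathbf{x}_n-\mathbf{s}_n}{\|\mathbf{x}_n-\mathbf{s}_n\|}+\mathbf{s}_n\right)$$ (which possess a root at $0$), both $|\theta_n|$ and $|\theta_n\circ(-\mathrm{Id})|$ satisfy the basic conditions (B1)--(B5) listed in the context. (vi) The functions $f_n=|\theta_n|$ satisfy case (iii)$^\dagger$ of the context, with corresponding $\epsilon_{f_n}>0$ and $\delta^{f_n}_{\rm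 RIGHT}>0$, and there is some $N>0$ such that $\min\{\epsilon_{f_n},\delta^{f_n}_{\rm RIGHT}\}\ge\|\mathbf{x}_n-\mathbf{s}_n\|>0$ for all $n\ge N$. Then for all $n>N$, $$\frac{\|\mathbf{x}_{n+1}-\mathbf{s}_n\|}{\|\mathbf{x}_n-\mathbf{s}_n\|^2}\le\frac{M_{\rm RIGHT}}{2},$$ where $M_{\rm RIGHT}=M_{\rm RIGHT}^{f_n}$ is the constant associated with $f_n$ and $\delta^{f_n}_{\rm RIGHT}$ in the context.
   Context: $A$ and $B$ are closed with $A\cap B\neq\emptyset$. For $S\subset\mathbb{R}^\eta$, $P_S\mathbf{x}$ denotes a (selected) nearest point of $S$ to $\mathbf{x}$; $R_S=2P_S-\mathrm{Id}$. The circumcenter $C(\mathbf{u},\mathbf{v},\mathbf{w})$ is the point of the affine hull of $\{\mathbf{u},\mathbf{v},\mathbf{w}\}$ equidistant from $\mathbf{u},\mathbf{v},\mathbf{w}$ (it fails to exist exactly when the three points are distinct and colinear), and $\mathrm{CRM}(\mathbf{x})=C(\mathbf{x},R_A\mathbf{x},R_BR_A\mathbf{x})$; the iterates $\mathbf{x}_n$ are assumed to be defined for all $n$. $\mathbb{B}_r(\mathbf{z})$ is the closed ball of radius $r$ about $\mathbf{z}$; $\operatorname{aff}$ is the affine hull. Basic conditions on $f:\mathbb{R}\to\mathbb{R}$: (B1) $f$ is continuous and $(0,0)$ is an isolated point of $\{(t,f(t)):t\in\mathbb{R}\}\cap(\mathbb{R}\times\{0\})$ (in particular $f(0)=0$);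 (B2) there is $\epsilon_1>0$ such that $0$ is the only root of $f$ on $[-\epsilon_1,\epsilon_1]$; (B3) $f$ is continuous on $[-\epsilon_1,\epsilon_1]$ and differentiable on $[-\epsilon_1,\epsilon_1]\setminus\{0\}$; (B4) there is $\epsilon_2>0$ such that $f$ is differentiable with $f'(t)\ne0$ for all $t\in[-\epsilon_2,\epsilon_2]\setminus\{0\}$; (B5) there is $\epsilon_3>0$ such that $f'$ is continuous and differentiable on $[-\epsilon_3,\epsilon_3]\setminus\{0\}$ with $f''(t)\neq0$ there. For such an $f$ (with fixed choices of $\epsilon_1,\epsilon_2,\epsilon_3$), $\epsilon_f:=\min\{\epsilon_1,\epsilon_2/2,\epsilon_3\}$. Case (iii)$^\dagger$ for $f$: $f''(t)>0$ for $t\in[0,\epsilon_f]$ and $f'(0)\neq0$ (right-sided derivatives at $t=0$). For $f$ in case (iii)$^\dagger$, $\delta^f_{\rm RIGHT}>0$ and $M^f_{\rm RIGHT}\in\mathbb{R}$ denote constants such that $\left|t-\frac{f(t)}{f'(t)}\right|<\frac{M^f_{\rm RIGHT}}{2}t^2$ for all $t\in(0,\delta^f_{\rm RIGHT}]$. *)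

theory Defs
  imports "HOL-Analysis.Analysis"
begin

definition is_nearest_point :: "'a::euclidean_space set \<Rightarrow> 'a \<Rightarrow> 'a \<Rightarrow> bool" where
  "is_nearest_point S x p \<longleftrightarrow> p \<in> S \<and> (\<forall>q\<in>S. dist x p \<le> dist x q)"

text \<open>
  Nearest points need not be unique, so a projector is a choice: \<open>P\<close> is a family of maps,
  \<open>P S x\<close> being the selected nearest point of \<open>S\<close> to \<open>x\<close>. The predicate says that \<open>P S\<close> is
  such a selection at the points of \<open>X\<close>; for sets \<open>S\<close> not known to be closed the
  selection can be required only where a nearest point exists.
\<close>
definition selects_nearest_on ::
    "('a::euclidean_space set \<Rightarrow> 'a \<Rightarrow> 'a) \<Rightarrow> 'a set \<Rightarrow> 'a set \<Rightarrow> bool" where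
  "selects_nearest_on P S X \<longleftrightarrow> (\<forall>x\<in>X. is_nearest_point S x (P S x))"

definition reflector ::
    "('a::euclidean_space set \<Rightarrow> 'a \<Rightarrow> 'a) \<Rightarrow> 'a set \<Rightarrow> 'a \<Rightarrow> 'a" where
  "reflector P S x = 2 *\<^sub>R P S x - x"

definition is_circumcenter :: "'a::euclidean_space \<Rightarrow> 'a \<Rightarrow> 'a \<Rightarrow> 'a \<Rightarrow> bool" where
  "is_circumcenter u v w c \<longleftrightarrow>
     c \<in> affine hull {u, v, w} \<and> dist c u = dist c v \<and> dist c v = dist c w"

lemma is_circumcenter_unique:
  assumes "is_circumcenter u v w c" and "is_circumcenter u v w d"
  shows "c = d"
proof -
  let ?e = "c - d"
  have eu: "?e \<bullet> u = ?e \<bullet> v" and ev: "?e \<bullet> v = ?e \<bullet> w"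
    using assms
    by (auto simp: is_circumcenter_def dist_norm norm_eq algebra_simps inner_commute)
  have const: "?e \<bullet> z = ?e \<bullet> u" if z: "z \<in> affine hull {u, v, w}" for z
  proof -
    from z obtain a b k where abk: "a + b + k = 1" "z = a *\<^sub>R u + b *\<^sub>R v + k *\<^sub>R w"
      by (auto simp: affine_hull_3)
    have "?e \<bullet> z = a * (?e \<bullet> u) + b * (?e \<bullet> v) + k * (?e \<bullet> w)"
      by (simp only: abk(2) inner_add_right inner_scaleR_right)
    also have "\<dots> = (a + b + k) * (?e \<bullet> u)"
      using eu ev by (simp only: distrib_right)
    finally show ?thesis using abk(1) by simp
  qed
  have "?e \<bullet> c = ?e \<bullet> d"
    using assms const by (simp add: is_circumcenter_def)
  then have "?e \<bullet> ?e = 0"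
    by (simp add: inner_diff_right)
  then show ?thesis by simp
qed

text \<open>Meaningful only if a circumcenter exists; existence is assumed separately where needed.\<close>
definition circumcenter :: "'a::euclidean_space \<Rightarrow> 'a \<Rightarrow> 'a \<Rightarrow> 'a" where
  "circumcenter u v w = (THE c. is_circumcenter u v w c)"

definition CRM ::
    "('a::euclidean_space set \<Rightarrow> 'a \<Rightarrow> 'a) \<Rightarrow> 'a set \<Rightarrow> 'a set \<Rightarrow> 'a \<Rightarrow> 'a" where
  "CRM P A B x = circumcenter x (reflector P A x) (reflector P B (reflector P A x))"

definition CRM_defined_at ::
    "('a::euclidean_space set \<Rightarrow> 'a \<Rightarrow> 'a) \<Rightarrow> 'a set \<Rightarrow> 'a set \<Rightarrow> 'a \<Rightarrow> bool" where
  "CRM_defined_at P A B x \<longleftrightarrow>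
     (\<exists>c. is_circumcenter x (reflector P A x) (reflector P B (reflector P A x)) c)"

text \<open>Only the values of \<open>\<Theta>\<close> on \<open>B\<close> matter.\<close>
definition gra :: "'a::euclidean_space set \<Rightarrow> 'a \<Rightarrow> ('a \<Rightarrow> real) \<Rightarrow> 'a set" where
  "gra B u \<Theta> = {x + \<Theta> x *\<^sub>R u | x. x \<in> B}"

definition B1 :: "(real \<Rightarrow> real) \<Rightarrow> bool" where
  "B1 f \<longleftrightarrow> continuous_on UNIV f \<and> (0, 0) isolated_in (range (\<lambda>t. (t, f t)) \<inter> UNIV \<times> {0})"

definition B2 :: "(real \<Rightarrow> real) \<Rightarrow> real \<Rightarrow> bool" where
  "B2 f e1 \<longleftrightarrow> e1 > 0 \<and> (\<forall>t\<in>{-e1..e1}. f t = 0 \<longleftrightarrow> t = 0)"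

definition B3 :: "(real \<Rightarrow> real) \<Rightarrow> real \<Rightarrow> bool" where
  "B3 f e1 \<longleftrightarrow> continuous_on {-e1..e1} f \<and> (\<forall>t\<in>{-e1..e1} - {0}. f differentiable (at t))"

definition B4 :: "(real \<Rightarrow> real) \<Rightarrow> real \<Rightarrow> bool" where
  "B4 f e2 \<longleftrightarrow> e2 > 0 \<and> (\<forall>t\<in>{-e2..e2} - {0}. f differentiable (at t) \<and> deriv f t \<noteq> 0)"

definition B5 :: "(real \<Rightarrow> real) \<Rightarrow> real \<Rightarrow> bool" where
  "B5 f e3 \<longleftrightarrow> e3 > 0 \<and>
     (\<forall>t\<in>{-e3..e3} - {0}. f differentiable (at t) \<and> isCont (deriv f) t \<and>
        deriv f differentiable (at t) \<and> deriv (deriv f) t \<noteq> 0)"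

definition basic_conditions :: "(real \<Rightarrow> real) \<Rightarrow> real \<Rightarrow> real \<Rightarrow> real \<Rightarrow> bool" where
  "basic_conditions f e1 e2 e3 \<longleftrightarrow> B1 f \<and> B2 f e1 \<and> B3 f e1 \<and> B4 f e2 \<and> B5 f e3"

definition eps_min :: "real \<Rightarrow> real \<Rightarrow> real \<Rightarrow> real" where
  "eps_min e1 e2 e3 = Min {e1, e2 / 2, e3}"

text \<open>
  The derivative taken within \<open>[0, \<infinity>)\<close> is the right-sided one at \<open>0\<close> and the ordinary
  two-sided one at every \<open>t > 0\<close>.
\<close>
definition deriv_right0 :: "(real \<Rightarrow> real) \<Rightarrow> real \<Rightarrow> real" where
  "deriv_right0 f t = vector_derivative f (at t within {0..})"

definition case_iii_dagger :: "(real \<Rightarrow> real) \<Rightarrow> real \<Rightarrow> bool" where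
  "case_iii_dagger f e \<longleftrightarrow>
     (\<forall>t\<in>{0..e}. f differentiable (at t within {0..}) \<and>
        deriv_right0 f differentiable (at t within {0..}) \<and>
        deriv_right0 (deriv_right0 f) t > 0) \<and>
     deriv_right0 f 0 \<noteq> 0"

definition right_newton_constants :: "(real \<Rightarrow> real) \<Rightarrow> real \<Rightarrow> real \<Rightarrow> bool" where
  "right_newton_constants f \<delta> M \<longleftrightarrow>
     \<delta> > 0 \<and> (\<forall>t\<in>{0<..\<delta>}. \<bar>t - f t / deriv f t\<bar> < M / 2 * t\<^sup>2)"

end

theory Submission
  imports Defs
begin

text \<open>
  The circumcentered step is a Newton step in disguise. Let \<open>x = x\<^sub>n\<close>, \<open>s = s\<^sub>n\<close>, and write the nearest
  point of the graph as \<open>z + h\<close> with \<open>z \<in> B\<close> and \<open>h = \<Theta> z u\<close> orthogonal to \<open>B\<close>. Reflecting \<open>x\<close> in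
  this point and then in \<open>B\<close> gives \<open>2z - x + 2h\<close> and \<open>2z - x - 2h\<close>, so a circumcenter lying in \<open>B\<close> must
  lie on the line through \<open>x\<close> and \<open>z\<close>, and equidistance fixes its position there
  (\<open>circumcenter_of_reflections_in_subspace\<close>). By hypothesis \<open>s\<close> lies on the line through consecutive
  iterates, which is this same line, so that the problem is one-dimensional: with the coordinate
  measured from \<open>s\<close> in the direction of \<open>x\<close>, the point \<open>x\<close> sits at \<open>d = \<parallel>x - s\<parallel>\<close>, \<open>z\<close> at some \<open>r\<close>,
  and the new iterate at \<open>r + k (f r)\<^sup>2 / (r - d)\<close>, where \<open>k = \<parallel>u\<parallel>\<^sup>2\<close> and \<open>f = f\<^sub>n\<close>. Here \<open>r \<noteq> d\<close>, because
  \<open>z = x\<close> would leave the iterate at \<open>x\<close> and so force \<open>s = x\<close>.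

  Since \<open>z + h\<close> is nearest to \<open>x\<close>, the number \<open>r\<close> minimizes \<open>(d - t)\<^sup>2 + k (f t)\<^sup>2\<close>. Because \<open>f\<close>
  vanishes at \<open>0\<close>, has a finite right-sided derivative there and increases on \<open>[0, 2d]\<close>, the minimizer
  lies in \<open>(0, d]\<close>, and Fermat's rule gives \<open>r - d = - k f(r) f'(r)\<close>
  (\<open>penalized_distance_minimizer\<close>). Substituting, \<open>k\<close> cancels and the new iterate sits at
  \<open>r - f(r) / f'(r)\<close>: it is the Newton iterate of \<open>f\<close> started at \<open>r\<close>. The Newton estimate at \<open>r\<close>
  together with \<open>0 < r \<le> d\<close> is the claim.
\<close>

lemma nearest_point_subspace_unique:
  fixes B :: "'a::euclidean_space set"
  assumes "subspace B" and "b \<in> B" and "h \<in> B\<^sup>\<bottom>" and "is_nearest_point B (b + h) p"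
  shows "p = b"
proof -
  have p: "p \<in> B" and "dist (b + h) p \<le> dist (b + h) b"
    using assms by (auto simp: is_nearest_point_def)
  then have "(norm ((b - p) + h))\<^sup>2 \<le> (norm h)\<^sup>2"
    by (simp add: dist_norm algebra_simps)
  moreover have "orthogonal (b - p) h"
    using assms p by (auto simp: orthogonal_comp_def intro: subspace_diff)
  ultimately have "(norm (b - p))\<^sup>2 \<le> 0"
    by (simp add: norm_add_Pythagorean)
  then show ?thesis by simp
qed

text \<open>
  The last two points differ by \<open>4h\<close>, which is orthogonal to \<open>B\<close>; a point of their affine hull with \<open>x\<close>
  can therefore lie in \<open>B\<close> only if its \<open>h\<close>-component vanishes. The multiplier then comes from
  comparing the distances to the first two points. For \<open>z = x\<close> the equations read \<open>c = x\<close> and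
  \<open>h = 0\<close>.
\<close>
lemma circumcenter_of_reflections_in_subspace:
  fixes B :: "'a::euclidean_space set"
  assumes B: "subspace B" and x: "x \<in> B" and z: "z \<in> B" and h: "h \<in> B\<^sup>\<bottom>" and c: "c \<in> B"
    and circ: "is_circumcenter x (2 *\<^sub>R (z + h) - x) (2 *\<^sub>R (z - h) - x) c"
  obtains l where "c = x + l *\<^sub>R (z - x)"
    and "l * (norm (z - x))\<^sup>2 = (norm (z - x))\<^sup>2 + (norm h)\<^sup>2"
proof -
  obtain a b k where abk: "a + b + k = 1"
    and c_eq: "c = a *\<^sub>R x + b *\<^sub>R (2 *\<^sub>R (z + h) - x) + k *\<^sub>R (2 *\<^sub>R (z - h) - x)"
    using circ by (auto simp: is_circumcenter_def affine_hull_3)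
  define l where "l = 2 * (b + k)"
  define g where "g = (2 * (b - k)) *\<^sub>R h"
  have a: "a = 1 - b - k" using abk by simp
  have c_split: "c = (x + l *\<^sub>R (z - x)) + g"
  proof -
    have double: "l *\<^sub>R (z - x) = 2 *\<^sub>R ((b + k) *\<^sub>R (z - x))" "g = 2 *\<^sub>R ((b - k) *\<^sub>R h)"
      by (simp_all add: l_def g_def)
    show ?thesis
      unfolding c_eq a double by (simp add: algebra_simps scaleR_2 del: scaleR_scaleR)
  qed
  have "x + l *\<^sub>R (z - x) \<in> B"
    using B x z by (intro subspace_add subspace_mul subspace_diff) auto
  then have "g \<in> B"
    using c c_split subspace_diff[OF B, of c "x + l *\<^sub>R (z - x)"] by simp
  moreover have "orthogonal w g" if "w \<in> B" for w
    using h that by (simp add: g_def orthogonal_comp_def orthogonal_clauses)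
  ultimately have "g = 0"
    by (metis orthogonal_self)
  then have c_line: "c = x + l *\<^sub>R (z - x)"
    using c_split by simp
  have zh: "orthogonal (z - x) h"
    using h subspace_diff[OF B z x] by (simp add: orthogonal_comp_def)
  have "dist c x = dist c (2 *\<^sub>R (z + h) - x)"
    using circ by (simp add: is_circumcenter_def)
  moreover have "c - (2 *\<^sub>R (z + h) - x) = (l - 2) *\<^sub>R (z - x) - 2 *\<^sub>R h"
    unfolding c_line by (simp add: algebra_simps scaleR_2)
  ultimately have "norm (l *\<^sub>R (z - x)) = norm ((l - 2) *\<^sub>R (z - x) - 2 *\<^sub>R h)"
    by (simp add: dist_norm c_line)
  then have "(norm (l *\<^sub>R (z - x)))\<^sup>2 = (norm ((l - 2) *\<^sub>R (z - x) - 2 *\<^sub>R h))\<^sup>2"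
    by simp
  also have "\<dots> = (norm ((l - 2) *\<^sub>R (z - x)))\<^sup>2 + (norm (2 *\<^sub>R h))\<^sup>2"
    using norm_add_Pythagorean[of "(l - 2) *\<^sub>R (z - x)" "- (2 *\<^sub>R h)"] zh
    by (simp add: orthogonal_clauses)
  finally have "l * (norm (z - x))\<^sup>2 = (norm (z - x))\<^sup>2 + (norm h)\<^sup>2"
    by (simp add: power_mult_distrib) (simp add: power2_eq_square algebra_simps)
  with c_line that show ?thesis by blast
qed

text \<open>
  By Rolle's theorem no value is taken twice, so \<open>f\<close> is monotone; the minimum \<open>0\<close> at the left end
  decides the direction.
\<close>
lemma nonneg_function_increasing_if_deriv_nonzero:
  fixes f :: "real \<Rightarrow> real"
  assumes cont: "continuous_on {0..b} f" and f0: "f 0 = 0" and nonneg: "\<And>t. f t \<ge> 0"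
    and diff: "\<And>t. t \<in> {0<..<b} \<Longrightarrow> f differentiable (at t) \<and> deriv f t \<noteq> 0"
    and "0 \<le> s" "s < t" "t \<le> b"
  shows "f s < f t"
proof (rule ccontr)
  assume "\<not> f s < f t"
  moreover have "continuous_on {0..s} f"
    using assms by (intro continuous_on_subset[OF cont]) auto
  ultimately obtain q where q: "0 \<le> q" "q \<le> s" "f q = f t"
    using IVT'[of f 0 "f t" s] f0 nonneg \<open>0 \<le> s\<close> by auto
  have "continuous_on {q..t} f"
    using assms q by (intro continuous_on_subset[OF cont]) auto
  moreover have "f differentiable (at v)" if "q < v" "v < t" for v
    using diff that q assms by auto
  ultimately obtain v where v: "q < v" "v < t" "DERIV f v :> 0"
    using Rolle[of q t f] q assms by auto
  then have "deriv f v = 0"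
    by (simp add: DERIV_imp_deriv)
  with diff[of v] v q assms show False by auto
qed

text \<open>
  Comparing with the value at \<open>0\<close> confines the minimizer to \<open>[0, 2d]\<close>; this is why the hypotheses
  reach up to \<open>2d\<close>. Monotonicity there rules out \<open>r > d\<close>, since moving back to \<open>d\<close> would remove the
  distance term without increasing the penalty. At \<open>0\<close> the finite right-sided derivative makes the
  penalty \<open>k (f t)\<^sup>2\<close> of second order, while \<open>(d - t)\<^sup>2\<close> decreases to first order, so \<open>0\<close> is no
  minimizer and Fermat's rule applies at \<open>r\<close>.
\<close>
lemma penalized_distance_minimizer:
  fixes f :: "real \<Rightarrow> real"
  assumes cont: "continuous_on {0..2 * d} f" and f0: "f 0 = 0" and nonneg: "\<And>t. f t \<ge> 0"
    and diff: "\<And>t. t \<in> {0<..2 * d} \<Longrightarrow> f differentiable (at t) \<and> deriv f t \<noteq> 0"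
    and right: "f differentiable (at 0 within {0..})"
    and d: "d > 0" and k: "k \<ge> 0"
    and min: "\<And>t. (d - r)\<^sup>2 + k * (f r)\<^sup>2 \<le> (d - t)\<^sup>2 + k * (f t)\<^sup>2"
  shows "0 < r" and "r \<le> d" and "r - d = - k * f r * deriv f r"
proof -
  have "(d - r)\<^sup>2 \<le> d\<^sup>2"
    using min[of 0] f0 mult_nonneg_nonneg[OF k zero_le_power2[of "f r"]] by auto
  then have "\<bar>d - r\<bar> \<le> d"
    using d abs_le_square_iff[of "d - r" d] by simp
  then have r_ge: "0 \<le> r" and r_le: "r \<le> 2 * d" by auto
  show "r \<le> d"
  proof (rule ccontr)
    assume "\<not> r \<le> d"
    then have "f d < f r"
      using nonneg_function_increasing_if_deriv_nonzero[OF cont f0 nonneg, of d r] diff d r_le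
      by auto
    then have "k * (f d)\<^sup>2 \<le> k * (f r)\<^sup>2"
      using nonneg k by (intro mult_left_mono power_mono) auto
    then have "(d - r)\<^sup>2 \<le> 0"
      using min[of d] by (simp only: diff_self power_zero_numeral)
    with \<open>\<not> r \<le> d\<close> show False by simp
  qed
  show r_pos: "0 < r"
  proof (rule ccontr)
    assume "\<not> 0 < r"
    with r_ge have [simp]: "r = 0" by simp
    obtain D where "(f has_real_derivative D) (at 0 within {0..})"
      using right by (auto simp: real_differentiable_def)
    then have D: "((\<lambda>t. (d - t)\<^sup>2 + k * (f t)\<^sup>2) has_real_derivative - 2 * d) (at 0 within {0..})"
      using f0 by (auto intro!: derivative_eq_intros)
    then obtain e where e: "e > 0"
      and "\<And>h. 0 < h \<Longrightarrow> 0 + h \<in> {0..} \<Longrightarrow> h < e \<Longrightarrow>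
        (d - (0 + h))\<^sup>2 + k * (f (0 + h))\<^sup>2 < (d - 0)\<^sup>2 + k * (f 0)\<^sup>2"
      using has_real_derivative_neg_dec_right[OF D] d by force
    from this(2)[of "e / 2"] min[of "e / 2"] e show False by simp
  qed
  define g where "g = (\<lambda>t. (d - t)\<^sup>2 + k * (f t)\<^sup>2)"
  have "(f has_real_derivative deriv f r) (at r)"
    using diff[of r] r_pos r_le
    by (auto simp: real_differentiable_def DERIV_imp_deriv)
  then have "(g has_real_derivative - 2 * (d - r) + k * (2 * f r * deriv f r)) (at r)"
    unfolding g_def by (auto intro!: derivative_eq_intros)
  then have "- 2 * (d - r) + k * (2 * f r * deriv f r) = 0"
    by (rule DERIV_local_min[of _ _ _ 1]) (use min in \<open>auto simp: g_def\<close>)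
  then show "r - d = - k * f r * deriv f r" by (simp add: algebra_simps)
qed

theorem theorem6p1:
  fixes A B :: "(real ^ 'n) set"
    and P :: "(real ^ 'n) set \<Rightarrow> real ^ 'n \<Rightarrow> real ^ 'n"
    and x0 y u :: "real ^ 'n"
    and x s :: "nat \<Rightarrow> real ^ 'n"
    and \<xi> :: real
    and \<Theta> :: "real ^ 'n \<Rightarrow> real"
    and \<theta> f :: "nat \<Rightarrow> real \<Rightarrow> real"
    and \<epsilon>1 \<epsilon>2 \<epsilon>3 \<delta> M :: "nat \<Rightarrow> real"
    and N :: nat
  assumes "closed A" and "closed B" and "A \<inter> B \<noteq> {}"
    and "subspace B" and "B \<noteq> UNIV"
    and "selects_nearest_on P A UNIV" and "selects_nearest_on P B UNIV"
    and "x0 \<in> B" and x_def: "\<And>n. x n = (CRM P A B ^^ n) x0"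
    and defined: "\<And>n. CRM_defined_at P A B (x n)"
    and i: "\<And>n. x n \<in> B"
    and ii: "x \<longlonglongrightarrow> y" "y \<in> B \<inter> A" "\<xi> > 0" "\<And>n. x n \<in> cball y \<xi>"
    and iii: "u \<in> B\<^sup>\<bottom> \<inter> cball 0 1"
      "selects_nearest_on P (gra B u \<Theta>) (range x)"
      "\<And>n. P A (x n) = P (gra B u \<Theta>) (x n)"
    and iv: "\<And>n. affine hull {x n, x (Suc n)} \<inter> A \<inter> B \<inter> cball y \<xi> = {s n}"
    and \<theta>_def: "\<And>n r. \<theta> n r = \<Theta> (r *\<^sub>R ((x n - s n) /\<^sub>R norm (x n - s n)) + s n)"
    and f_def: "\<And>n r. f n r = \<bar>\<theta> n r\<bar>"
    and v: "\<And>n. basic_conditions (f n) (\<epsilon>1 n) (\<epsilon>2 n) (\<epsilon>3 n)"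
      "\<And>n. \<exists>e1 e2 e3. basic_conditions (\<lambda>r. \<bar>\<theta> n (- r)\<bar>) e1 e2 e3"
    and vi: "\<And>n. case_iii_dagger (f n) (eps_min (\<epsilon>1 n) (\<epsilon>2 n) (\<epsilon>3 n))"
      "\<And>n. right_newton_constants (f n) (\<delta> n) (M n)"
      "N > 0"
      "\<And>n. n \<ge> N \<Longrightarrow> min (eps_min (\<epsilon>1 n) (\<epsilon>2 n) (\<epsilon>3 n)) (\<delta> n) \<ge> norm (x n - s n)"
      "\<And>n. n \<ge> N \<Longrightarrow> norm (x n - s n) > 0"
  shows "\<forall>n>N. norm (x (Suc n) - s n) / (norm (x n - s n))\<^sup>2 \<le> M n / 2"
proof (intro allI impI)
  fix n assume "n > N"
  then have n: "n \<ge> N" by simp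
  note subB = \<open>subspace B\<close>
  define d where "d = norm (x n - s n)"
  define e where "e = (x n - s n) /\<^sub>R d"
  define k where "k = (norm u)\<^sup>2"
  have d: "d > 0" and d_eps: "d \<le> eps_min (\<epsilon>1 n) (\<epsilon>2 n) (\<epsilon>3 n)" and d_\<delta>: "d \<le> \<delta> n"
    using vi(4,5)[OF n] by (auto simp: d_def)
  have norm_e: "norm e = 1" using d by (simp add: e_def d_def)
  have x_eq: "x n = s n + d *\<^sub>R e" using d by (simp add: e_def)
  have \<theta>_eq: "\<theta> n t = \<Theta> (s n + t *\<^sub>R e)" for t
    by (simp add: \<theta>_def e_def d_def add.commute)
  have s: "s n \<in> affine hull {x n, x (Suc n)}" "s n \<in> B" using iv[of n] by auto
  have uB: "u \<in> B\<^sup>\<bottom>" using iii(1) by simp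
  have e_B: "e \<in> B" unfolding e_def using subB i s by (intro subspace_mul subspace_diff) auto

  have circ: "is_circumcenter (x n) (reflector P A (x n))
      (reflector P B (reflector P A (x n))) (x (Suc n))"
  proof -
    obtain c where c: "is_circumcenter (x n) (reflector P A (x n))
        (reflector P B (reflector P A (x n))) c"
      using defined[of n] by (auto simp: CRM_defined_at_def)
    then have "CRM P A B (x n) = c"
      unfolding CRM_def circumcenter_def
      by (intro the_equality) (auto intro: is_circumcenter_unique)
    then show ?thesis using c by (simp add: x_def)
  qed

  have nearest: "is_nearest_point (gra B u \<Theta>) (x n) (P A (x n))"
    using iii(2,3) by (simp add: selects_nearest_on_def)
  then obtain z where z: "z \<in> B" and PA: "P A (x n) = z + \<Theta> z *\<^sub>R u"
    by (auto simp: is_nearest_point_def gra_def)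
  define h where "h = \<Theta> z *\<^sub>R u"
  have h_perp: "a *\<^sub>R h \<in> B\<^sup>\<bottom>" for a
    using uB by (simp add: h_def orthogonal_comp_def orthogonal_clauses)
  have RA: "reflector P A (x n) = 2 *\<^sub>R (z + h) - x n"
    by (simp add: reflector_def PA h_def)
  have PB: "P B (reflector P A (x n)) = 2 *\<^sub>R z - x n"
  proof (rule nearest_point_subspace_unique[OF subB])
    show "2 *\<^sub>R z - x n \<in> B" using subB z i by (intro subspace_diff subspace_mul) auto
    show "2 *\<^sub>R h \<in> B\<^sup>\<bottom>" by (rule h_perp)
    show "is_nearest_point B (2 *\<^sub>R z - x n + 2 *\<^sub>R h) (P B (reflector P A (x n)))"
      using \<open>selects_nearest_on P B UNIV\<close> unfolding RA
      by (auto simp: selects_nearest_on_def algebra_simps)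
  qed
  have RB: "reflector P B (reflector P A (x n)) = 2 *\<^sub>R (z - h) - x n"
    unfolding reflector_def[of P B] PB unfolding RA by (simp add: algebra_simps scaleR_2)
  obtain l where step: "x (Suc n) = x n + l *\<^sub>R (z - x n)"
    and l: "l * (norm (z - x n))\<^sup>2 = (norm (z - x n))\<^sup>2 + (norm h)\<^sup>2"
    using circumcenter_of_reflections_in_subspace[OF subB i z _ i circ[unfolded RB, unfolded RA]]
      h_perp[of 1] by (metis scaleR_one)

  obtain a where "s n = x n + a *\<^sub>R (x (Suc n) - x n)"
    using s(1) by (auto simp: affine_hull_2_alt)
  then have s_line: "s n = x n + (a * l) *\<^sub>R (z - x n)" by (simp add: step)
  then have "a * l \<noteq> 0" "z \<noteq> x n" using d by (auto simp: d_def)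
  \<comment> \<open>Solving the previous equation for \<open>z\<close> with \<open>x n - s n = d *\<^sub>R e\<close>.\<close>
  define r where "r = d - d / (a * l)"
  have z_eq: "z = s n + r *\<^sub>R e"
  proof -
    have "(a * l) *\<^sub>R (z - x n) = - (d *\<^sub>R e)"
      using s_line x_eq by (simp add: algebra_simps)
    then have "inverse (a * l) *\<^sub>R ((a * l) *\<^sub>R (z - x n)) = inverse (a * l) *\<^sub>R (- (d *\<^sub>R e))"
      by simp
    then have "z - x n = - ((d / (a * l)) *\<^sub>R e)"
      using \<open>a * l \<noteq> 0\<close> by (simp add: field_simps)
    then show ?thesis by (simp add: r_def x_eq algebra_simps)
  qed
  have zx: "z - x n = (r - d) *\<^sub>R e" by (simp add: z_eq x_eq algebra_simps)
  have rd: "r \<noteq> d" using \<open>z \<noteq> x n\<close> zx by auto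
  have norm_h: "(norm h)\<^sup>2 = k * (f n r)\<^sup>2"
    by (simp add: h_def k_def f_def \<theta>_eq z_eq power_mult_distrib)

  \<comment> \<open>The graph points above the line through \<open>s n\<close> and \<open>x n\<close> compete with the nearest point, by
    Pythagoras at squared distance \<open>(d - t)\<^sup>2 + k * (f n t)\<^sup>2\<close>.\<close>
  have min: "(d - r)\<^sup>2 + k * (f n r)\<^sup>2 \<le> (d - t)\<^sup>2 + k * (f n t)\<^sup>2" for t
  proof -
    have sq: "(dist (x n) ((s n + q *\<^sub>R e) + \<Theta> (s n + q *\<^sub>R e) *\<^sub>R u))\<^sup>2
        = (d - q)\<^sup>2 + k * (f n q)\<^sup>2" for q
    proof -
      have "orthogonal ((d - q) *\<^sub>R e) (- (\<theta> n q *\<^sub>R u))"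
        using uB e_B by (simp add: orthogonal_comp_def orthogonal_clauses)
      then have "(norm ((d - q) *\<^sub>R e + - (\<theta> n q *\<^sub>R u)))\<^sup>2 = (d - q)\<^sup>2 + k * (f n q)\<^sup>2"
        by (subst norm_add_Pythagorean) (simp_all add: norm_e power_mult_distrib k_def f_def)
      then show ?thesis by (simp add: dist_norm x_eq \<theta>_eq algebra_simps)
    qed
    have "s n + t *\<^sub>R e \<in> B"
      using subB s e_B by (intro subspace_add subspace_mul) auto
    then have "dist (x n) (z + \<Theta> z *\<^sub>R u)
        \<le> dist (x n) ((s n + t *\<^sub>R e) + \<Theta> (s n + t *\<^sub>R e) *\<^sub>R u)"
      using nearest by (auto simp: is_nearest_point_def PA gra_def)
    then show ?thesis
      unfolding sq[symmetric] z_eq by (intro power_mono zero_le_dist)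
  qed

  have bc: "B1 (f n)" "B2 (f n) (\<epsilon>1 n)" "B4 (f n) (\<epsilon>2 n)"
    using v(1)[of n] by (auto simp: basic_conditions_def)
  \<comment> \<open>The halving of \<open>\<epsilon>2\<close> in \<open>eps_min\<close> is what gives control up to \<open>2 * d\<close>.\<close>
  have d_\<epsilon>2: "2 * d \<le> \<epsilon>2 n" using d_eps by (simp add: eps_min_def)
  have f0: "f n 0 = 0" using bc(2) by (auto simp: B2_def)
  have cont: "continuous_on {0..2 * d} (f n)"
    using bc(1) by (auto simp: B1_def intro: continuous_on_subset)
  have diff: "f n differentiable (at t) \<and> deriv (f n) t \<noteq> 0" if "t \<in> {0<..2 * d}" for t
    using bc(3) that d_\<epsilon>2 by (auto simp: B4_def)
  have right: "f n differentiable (at 0 within {0..})"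
    using vi(1)[of n] d d_eps by (auto simp: case_iii_dagger_def)
  have nonneg: "f n t \<ge> 0" for t by (simp add: f_def)
  have "k \<ge> 0" by (simp add: k_def)
  note minimizer = penalized_distance_minimizer[OF cont f0 nonneg diff right d this min]
  have r: "0 < r" "r \<le> d" and fermat: "r - d = - k * f n r * deriv (f n) r"
    using minimizer by auto

  have "l * (r - d)\<^sup>2 = (r - d)\<^sup>2 + k * (f n r)\<^sup>2"
    using l by (simp add: zx norm_e norm_h power_mult_distrib)
  then have "l * (r - d) = (r - d) + k * (f n r)\<^sup>2 / (r - d)"
    using rd by (simp add: field_simps power2_eq_square)
  also have "k * (f n r)\<^sup>2 / (r - d) = - (f n r / deriv (f n) r)"
  proof -
    have "k * f n r * deriv (f n) r \<noteq> 0" using rd fermat by auto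
    then show ?thesis unfolding fermat by (simp add: field_simps power2_eq_square)
  qed
  finally have newton: "d + l * (r - d) = r - f n r / deriv (f n) r" by simp
  have "x (Suc n) - s n = (d + l * (r - d)) *\<^sub>R e"
    unfolding step zx by (simp add: x_eq algebra_simps)
  then have "norm (x (Suc n) - s n) = \<bar>r - f n r / deriv (f n) r\<bar>"
    by (simp add: newton norm_e)
  also have bound: "\<dots> < M n / 2 * r\<^sup>2"
    using vi(2)[of n] r d_\<delta> by (auto simp: right_newton_constants_def)
  also have "\<dots> \<le> M n / 2 * d\<^sup>2"
  proof (intro mult_left_mono power_mono)
    \<comment> \<open>The bounded quantity is an absolute value, so the constant cannot be negative.\<close>
    have "0 < M n / 2 * r\<^sup>2" using bound by (rule le_less_trans[OF abs_ge_zero])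
    then show "0 \<le> M n / 2" using r by (simp add: zero_less_mult_iff)
  qed (use r in auto)
  finally show "norm (x (Suc n) - s n) / (norm (x n - s n))\<^sup>2 \<le> M n / 2"
    using d by (simp add: d_def[symmetric] divide_le_eq)
qed

end
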